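(* Let $\{a_n\}_{n\ge 0}$ be a strictly positive sequence in $\mathbb{R}$ such that $\lim_{n\to\infty} a_n^{2^{-n}}=0$ and $0<a_{n+1}<a_n^2<1$ for every $n\ge 0$. Let $P$ be a polynomial in one variable with positive coefficients and $P(0)=c_0>0$, and for $n \ge 0$ let $F_n\in \mathsf{Aut}_0(\mathbb{C}^2)$ be $$F_n(z_1,z_2)=\big(a_n z_2+z_1^2P(z_1),\ a_n z_1\big).$$ Then the basin of attraction $\Omega_{\{F_n\}}$ of the sequence $\{F_n\}$ at the origin is a Short $\mathbb{C}^2$.
   Context: $\mathsf{Aut}_0(\mathbb{C}^k)$ denotes the group of (holomorphic) automorphisms of $\mathbb{C}^k$ fixing the origin. For a sequence $\{F_n\}_{n\ge 0}\subset \mathsf{Aut}_0(\mathbb{C}^k)$ put $F(n)=F_n\circ\cdots\circ F_0$; the (non-autonomous) basin of attraction at the origin is $\Omega_{\{F_n\}}=\{z\in\mathbb{C}^k: F(n)(z)\to 0 \text{ as } n\to\infty\}$. A Short $\mathbb{C}^k$ is a proper subdomain $\Omega\subset\mathbb{C}^k$ such that: (i) $\Omega=\bigcup_n\Omega_n$ with $\Omega_n\subset\Omega_{n+1}$, where each $\Omega_n$ is biholomorphic to the unit ball $B^k(0;1)$; (ii) the infinitesimal Kobayashi metric of $\Omega$ vanishes identically; (iii) $\Omega$ admits a non-constant plurisubharmonic function that is bounded above. *)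

theory Defs
  imports "HOL-Complex_Analysis.Complex_Analysis"
begin

section \<open>Holomorphic maps and automorphisms of \<open>\<complex>\<^sup>k\<close>\<close>

text \<open>
  \<open>\<complex>\<^sup>k\<close> is \<open>complex ^ 'k\<close>, whose norm is the Euclidean one.  A map is holomorphic if its (real)
  Frechet derivative exists and is complex linear; \<open>*s\<close> is multiplication by complex scalars.
\<close>

definition holomorphic_map_on :: "(complex ^ 'k \<Rightarrow> complex ^ 'm) \<Rightarrow> (complex ^ 'k) set \<Rightarrow> bool"
  where "holomorphic_map_on f S \<longleftrightarrow>
    (\<forall>z\<in>S. \<exists>D. (f has_derivative D) (at z) \<and> (\<forall>c v. D (c *s v) = c *s D v))"

definition biholomorphism :: "(complex ^ 'k) set \<Rightarrow> (complex ^ 'k) set \<Rightarrow> (complex ^ 'k \<Rightarrow> complex ^ 'k) \<Rightarrow> bool"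
  where "biholomorphism S T f \<longleftrightarrow>
    open S \<and> open T \<and> bij_betw f S T \<and>
    holomorphic_map_on f S \<and> holomorphic_map_on (inv_into S f) T"

definition biholomorphic :: "(complex ^ 'k) set \<Rightarrow> (complex ^ 'k) set \<Rightarrow> bool"
  where "biholomorphic S T \<longleftrightarrow> (\<exists>f. biholomorphism S T f)"

definition Aut0 :: "(complex ^ 'k \<Rightarrow> complex ^ 'k) set"
  where "Aut0 = {f. biholomorphism UNIV UNIV f \<and> f 0 = 0}"


section \<open>Non-autonomous basins of attraction\<close>

primrec iterate_seq :: "(nat \<Rightarrow> 'a \<Rightarrow> 'a) \<Rightarrow> nat \<Rightarrow> 'a \<Rightarrow> 'a"
  where
    "iterate_seq F 0 = F 0"
  | "iterate_seq F (Suc n) = F (Suc n) \<circ> iterate_seq F n"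

definition basin :: "(nat \<Rightarrow> complex ^ 'k \<Rightarrow> complex ^ 'k) \<Rightarrow> (complex ^ 'k) set"
  where "basin F = {z. (\<lambda>n. iterate_seq F n z) \<longlonglongrightarrow> 0}"


section \<open>The infinitesimal Kobayashi metric\<close>

definition holomorphic_disc :: "(complex \<Rightarrow> complex ^ 'k) \<Rightarrow> (complex ^ 'k) set \<Rightarrow> bool"
  where "holomorphic_disc f \<Omega> \<longleftrightarrow>
    f ` ball 0 1 \<subseteq> \<Omega> \<and> (\<forall>i. (\<lambda>\<zeta>. f \<zeta> $ i) holomorphic_on ball 0 1)"

text \<open>For open \<open>\<Omega>\<close> and \<open>z \<in> \<Omega>\<close> the set below is nonempty, so the real infimum is meaningful.\<close>

definition kobayashi_metric :: "(complex ^ 'k) set \<Rightarrow> complex ^ 'k \<Rightarrow> complex ^ 'k \<Rightarrow> real"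
  where "kobayashi_metric \<Omega> z \<xi> =
    Inf {\<alpha>. \<alpha> > 0 \<and> (\<exists>f. holomorphic_disc f \<Omega> \<and> f 0 = z \<and>
                         \<alpha> *\<^sub>R (\<chi> i. deriv (\<lambda>\<zeta>. f \<zeta> $ i) 0) = \<xi>)}"


section \<open>Plurisubharmonic functions\<close>

text \<open>
  The Lebesgue integral over \<open>[0, 2\<pi>]\<close> of an extended real function, as the integral of its
  positive part minus that of its negative part (\<open>e2ennreal\<close> sends negative values to \<open>0\<close>).  For an
  upper semicontinuous function with values in \<open>[-\<infinity>, \<infinity>)\<close> on a circle the first integral is finite,
  so the difference is well defined in \<open>[-\<infinity>, \<infinity>)\<close>.
\<close>

definition circle_integral :: "(real \<Rightarrow> ereal) \<Rightarrow> ereal"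
  where "circle_integral g =
    enn2ereal (\<integral>\<^sup>+\<theta>\<in>{0..2*pi}. e2ennreal (g \<theta>) \<partial>lborel) -
    enn2ereal (\<integral>\<^sup>+\<theta>\<in>{0..2*pi}. e2ennreal (- g \<theta>) \<partial>lborel)"

definition plurisubharmonic_on :: "(complex ^ 'k \<Rightarrow> ereal) \<Rightarrow> (complex ^ 'k) set \<Rightarrow> bool"
  where "plurisubharmonic_on u \<Omega> \<longleftrightarrow>
    (\<forall>z\<in>\<Omega>. u z < \<infinity>) \<and>
    (\<forall>c. openin (top_of_set \<Omega>) {z\<in>\<Omega>. u z < c}) \<and>
    (\<forall>z w. (\<forall>\<zeta>\<in>cball 0 1. z + \<zeta> *s w \<in> \<Omega>) \<longrightarrow>
       u z \<le> ereal (1 / (2 * pi)) * circle_integral (\<lambda>\<theta>. u (z + cis \<theta> *s w)))"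


section \<open>Short \<open>\<complex>\<^sup>k\<close>\<close>

definition short_Ck :: "(complex ^ 'k) set \<Rightarrow> bool"
  where "short_Ck \<Omega> \<longleftrightarrow>
    open \<Omega> \<and> connected \<Omega> \<and> \<Omega> \<noteq> {} \<and> \<Omega> \<noteq> UNIV \<and>
    (\<exists>W :: nat \<Rightarrow> (complex ^ 'k) set.
       \<Omega> = (\<Union>n. W n) \<and> (\<forall>n. W n \<subseteq> W (Suc n)) \<and> (\<forall>n. biholomorphic (W n) (ball 0 1))) \<and>
    (\<forall>z\<in>\<Omega>. \<forall>\<xi>. kobayashi_metric \<Omega> z \<xi> = 0) \<and>
    (\<exists>u. plurisubharmonic_on u \<Omega> \<and> (\<exists>z\<in>\<Omega>. \<exists>w\<in>\<Omega>. u z \<noteq> u w) \<and>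
         (\<exists>M::real. \<forall>z\<in>\<Omega>. u z \<le> ereal M))"


section \<open>The maps of the theorem are automorphisms\<close>

lemma holomorphic_map_onI_components:
  fixes f :: "complex ^ 'k \<Rightarrow> complex ^ 'm"
  assumes "\<And>z i. z \<in> S \<Longrightarrow> ((\<lambda>x. f x $ i) has_derivative D z i) (at z)"
    and "\<And>z i c v. z \<in> S \<Longrightarrow> D z i (c *s v) = c * D z i v"
  shows "holomorphic_map_on f S"
  unfolding holomorphic_map_on_def
proof
  fix z assume z: "z \<in> S"
  have ax: "bounded_linear (axis i :: complex \<Rightarrow> complex ^ 'm)" for i
    by (rule linear_conv_bounded_linear[THEN iffD1], rule linearI)
       (auto simp: axis_def vec_eq_iff)
  have eq: "(\<Sum>i\<in>UNIV. axis i (y $ i)) = y" for y :: "complex ^ 'm"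
    by (auto simp: vec_eq_iff axis_def sum_component if_distrib cong: if_cong)
  have "((\<lambda>x. \<Sum>i\<in>UNIV. axis i (f x $ i)) has_derivative (\<lambda>h. \<Sum>i\<in>UNIV. axis i (D z i h))) (at z)"
    by (intro has_derivative_sum bounded_linear.has_derivative[OF ax] assms(1) z)
  then have "(f has_derivative (\<lambda>h. \<Sum>i\<in>UNIV. axis i (D z i h))) (at z)"
    by (simp add: eq)
  moreover have "(\<Sum>i\<in>UNIV. axis i (D z i (c *s v))) = c *s (\<Sum>i\<in>UNIV. axis i (D z i v))" for c v
    using assms(2)[OF z]
    by (auto simp: vec_eq_iff axis_def sum_component if_distrib cong: if_cong)
  ultimately show "\<exists>D. (f has_derivative D) (at z) \<and> (\<forall>c v. D (c *s v) = c *s D v)"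
    by blast
qed

lemma holomorphic_map_on_vector2:
  fixes g :: "complex \<Rightarrow> complex"
  assumes g: "\<And>x. (g has_field_derivative g' x) (at x)"
  shows "holomorphic_map_on (\<lambda>z :: complex ^ 2. vector [c * z $ i + g (z $ j), d * z $ l] :: complex ^ 2) S"
proof (rule holomorphic_map_onI_components
    [where D = "\<lambda>(z :: complex ^ 2) m (h :: complex ^ 2). if m = 1 then c * h $ i + g' (z $ j) * h $ j else d * h $ l"])
  fix z :: "complex ^ 2" and m :: 2
  have nth: "((\<lambda>x :: complex ^ 2. x $ k) has_derivative (\<lambda>h. h $ k)) (at z)" for k
    by (intro bounded_linear_imp_has_derivative bounded_linear_vec_nth)
  have "((\<lambda>x. g (x $ j)) has_derivative (\<lambda>h. g' (z $ j) * h $ j)) (at z)"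
    using has_derivative_compose[OF nth] g[of "z $ j"] unfolding has_field_derivative_def by fast
  then show "((\<lambda>x. (vector [c * x $ i + g (x $ j), d * x $ l] :: complex ^ 2) $ m) has_derivative
      (\<lambda>h. if m = 1 then c * h $ i + g' (z $ j) * h $ j else d * h $ l)) (at z)"
    using exhaust_2[of m]
    by (auto intro!: has_derivative_add has_derivative_mult_right nth)
qed (auto simp: algebra_simps)

lemma henon_map_in_Aut0:
  fixes a :: real and P :: "real poly"
  assumes "a > 0"
  shows "(\<lambda>z :: complex ^ 2.
    vector [of_real a * z $ 2 + (z $ 1)\<^sup>2 * poly (map_poly of_real P) (z $ 1),
            of_real a * z $ 1]) \<in> Aut0" (is "?F \<in> Aut0")
proof -
  define c where "c = complex_of_real a"
  have c: "c \<noteq> 0" using assms by (simp add: c_def)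
  define p :: "complex poly" where "p = map_poly of_real P"
  define q where "q x = x\<^sup>2 * poly p x" for x :: complex
  define q' where "q' x = 2 * x * poly p x + x\<^sup>2 * poly (pderiv p) x" for x :: complex
  define G :: "complex ^ 2 \<Rightarrow> complex ^ 2"
    where "G w = vector [inverse c * w $ 2,
                         inverse c * (w $ 1 - q (inverse c * w $ 2))]" for w
  have q: "(q has_field_derivative q' x) (at x)" for x
    unfolding q_def q'_def by (auto intro!: derivative_eq_intros)
  define H where "H = ?F"
  have F_eq: "H = (\<lambda>z. vector [c * z $ 2 + q (z $ 1), c * z $ 1])"
    by (simp add: H_def q_def p_def c_def)
  have FG: "H (G w) = w" and GF: "G (H w) = w" for w
    using c by (auto simp: F_eq G_def vec_eq_iff forall_2 field_simps)
  have bij: "bij H"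
    by (rule o_bij[of G]) (auto simp: FG GF)
  have inv: "inv H = G"
    by (rule inv_equality) (auto simp: FG GF)
  have holF: "holomorphic_map_on H UNIV"
    unfolding F_eq by (rule holomorphic_map_on_vector2[OF q])
  have holG: "holomorphic_map_on G UNIV"
  proof (rule holomorphic_map_onI_components
      [where D = "\<lambda>(w :: complex ^ 2) m (h :: complex ^ 2). if m = 1 then inverse c * h $ 2
         else inverse c * (h $ 1 - q' (inverse c * w $ 2) * (inverse c * h $ 2))"])
    fix w :: "complex ^ 2" and m :: 2
    have nth: "((\<lambda>x :: complex ^ 2. x $ k) has_derivative (\<lambda>h. h $ k)) (at w)" for k
      by (intro bounded_linear_imp_has_derivative bounded_linear_vec_nth)
    have sc: "((\<lambda>x :: complex ^ 2. inverse c * x $ 2) has_derivative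
        (\<lambda>h. inverse c * h $ 2)) (at w)"
      by (intro has_derivative_mult_right nth)
    have "((\<lambda>x. q (inverse c * x $ 2)) has_derivative
        (\<lambda>h. q' (inverse c * w $ 2) * (inverse c * h $ 2))) (at w)"
      using has_derivative_compose[OF sc] q[of "inverse c * w $ 2"]
      unfolding has_field_derivative_def by fast
    then show "((\<lambda>x. G x $ m) has_derivative (\<lambda>h. if m = 1 then inverse c * h $ 2
         else inverse c * (h $ 1 - q' (inverse c * w $ 2) * (inverse c * h $ 2)))) (at w)"
      unfolding G_def using exhaust_2[of m] sc
      by (auto intro!: has_derivative_diff has_derivative_mult_right nth)
  qed (auto simp: algebra_simps)
  have "H 0 = 0"
    by (simp add: F_eq q_def vec_eq_iff forall_2)
  then have "H \<in> Aut0"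
    using bij holF holG by (simp add: Aut0_def biholomorphism_def inv)
  then show ?thesis by (simp only: H_def)
qed

end

theory Submission
  imports Defs
begin

text \<open>
  Let \<open>G n = F n \<circ> \<dots> \<circ> F 0\<close>.  Since \<open>a n \<rightarrow> 0\<close> and the nonlinear part of \<open>F n\<close> is quadratic, all
  \<open>F n\<close> with \<open>n \<ge> N\<close> contract a small ball of radius \<open>r\<close>, so the basin is the increasing union of the
  sets \<open>W n = {z. norm (G n z) < r}\<close>.  The image under the inverse of \<open>G n\<close> of an affine disc of fixed
  size around \<open>G n z\<close> lies in \<open>W n\<close>, and its derivative can be made arbitrarily large in a given
  direction because, by Cauchy's estimate, the derivatives of \<open>G n\<close> at \<open>z\<close> tend to \<open>0\<close>; hence the
  Kobayashi metric vanishes.  Writing \<open>x n\<close> for the first coordinate of \<open>G n z\<close>, the functions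
  \<open>2 ^ (- n) * ln (max \<bar>x n\<bar> (a n))\<close> are, up to a summable correction, decreasing in \<open>n\<close> on each
  \<open>W m\<close>, so their limit \<open>u\<close> is plurisubharmonic and nonpositive.  The hypothesis on
  \<open>a n powr (2 powr (- n))\<close> gives \<open>u 0 = -\<infinity>\<close>, whereas along the positive first axis
  \<open>x (n + 1) \<ge> P(0) * (x n)\<^sup>2\<close>, so that \<open>u\<close> is finite there and \<open>G n z\<close> does not tend to \<open>0\<close> far out.
\<close>


section \<open>Submean value inequalities\<close>

text \<open>Makes the Riemann sum bound below independent of the starting angle:
  \<open>{T..s+T}\<close> is a translate of \<open>{0..s}\<close>.\<close>

lemma integral_periodic_shift:
  fixes g :: "real \<Rightarrow> real"
  assumes cont: "continuous_on UNIV g" and per: "\<And>t. g (t + T) = g t" and "0 \<le> s" "s \<le> T"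
  shows "integral {s..s+T} g = integral {0..T} g"
proof -
  have int: "g integrable_on {u..v}" for u v
    by (rule integrable_continuous_real) (rule continuous_on_subset[OF cont], simp)
  have "integral {0..s} g + integral {s..T} g = integral {0..T} g"
    using assms int by (intro Henstock_Kurzweil_Integration.integral_combine) auto
  moreover have "integral {s..T} g + integral {T..s+T} g = integral {s..s+T} g"
    using assms int by (intro Henstock_Kurzweil_Integration.integral_combine) auto
  moreover have "integral {0..s} g = integral {T..s+T} g"
  proof -
    have "g = g \<circ> (\<lambda>x. x + T)" by (auto simp: per)
    moreover have "integral {0..s} (g \<circ> (\<lambda>x. x + T)) = integral {0+T..s+T} g"
      by (rule integral_shift) (rule continuous_on_subset[OF cont], simp)
    ultimately show ?thesis by simp
  qed
  ultimately show ?thesis by simp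
qed

text \<open>On each step the left endpoint value exceeds \<open>g\<close> by at most
  \<open>e\<close>, so the total error is \<open>e\<close> times the length of the interval.\<close>

lemma riemann_sum_le_integral:
  fixes g :: "real \<Rightarrow> real"
  assumes int: "g integrable_on {s..s + c * real n}" and c: "0 \<le> c"
    and osc: "\<And>u v. u \<in> {s..s + c * real n} \<Longrightarrow> v \<in> {s..s + c * real n} \<Longrightarrow> \<bar>u - v\<bar> \<le> c \<Longrightarrow> g u \<le> g v + e"
  shows "c * (\<Sum>j<n. g (s + c * real j)) \<le> integral {s..s + c * real n} g + c * real n * e"
proof -
  have "k \<le> n \<Longrightarrow> c * (\<Sum>j<k. g (s + c * real j)) \<le> integral {s..s + c * real k} g + c * real k * e" for k
  proof (induction k)
    case (Suc k)
    have le: "c * real k \<le> c * real (Suc k)" "c * real (Suc k) \<le> c * real n" "0 \<le> c * real k"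
      using c Suc.prems by (auto intro!: mult_left_mono)
    have i1: "g integrable_on {s..s + c * real (Suc k)}"
      by (rule integrable_subinterval_real[OF int]) (use le in auto)
    have i2: "g integrable_on {s + c * real k..s + c * real (Suc k)}"
      by (rule integrable_subinterval_real[OF int]) (use le in auto)
    have "integral {s + c * real k..s + c * real (Suc k)} (\<lambda>_. g (s + c * real k) - e)
        \<le> integral {s + c * real k..s + c * real (Suc k)} g"
    proof (rule integral_le[OF _ i2])
      fix v assume v: "v \<in> {s + c * real k..s + c * real (Suc k)}"
      have "g (s + c * real k) \<le> g v + e"
        by (rule osc) (use v le in \<open>auto simp: algebra_simps intro: order_trans[rotated]\<close>)
      then show "g (s + c * real k) - e \<le> g v" by simp
    qed auto
    moreover have "integral {s + c * real k..s + c * real (Suc k)} (\<lambda>_. g (s + c * real k) - e)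
        = c * (g (s + c * real k) - e)"
      using le by (simp add: algebra_simps)
    moreover have "integral {s..s + c * real k} g + integral {s + c * real k..s + c * real (Suc k)} g
        = integral {s..s + c * real (Suc k)} g"
      by (rule Henstock_Kurzweil_Integration.integral_combine[OF _ _ i1]) (use le in auto)
    ultimately show ?case
      using Suc by (simp add: algebra_simps)
  qed simp
  then show ?thesis by blast
qed

text \<open>
  The maximum principle is applied to the product of the rotations of \<open>f\<close> by the \<open>m\<close>-th roots of
  unity: on the circle the logarithm of its modulus is bounded by a Riemann sum of the integral.
  Unlike factoring out the zeros, this needs no integrability of \<open>ln \<bar>f\<bar>\<close>.
\<close>

lemma ln_max_mean_value:
  fixes f :: "complex \<Rightarrow> complex"
  assumes hol: "f holomorphic_on UNIV" and a: "0 < a"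
  shows "2 * pi * ln (max (cmod (f 0)) a) \<le> integral {0..2*pi} (\<lambda>t. ln (max (cmod (f (cis t))) a))"
proof -
  define g where "g = (\<lambda>t. ln (max (cmod (f (cis t))) a))"
  define A where "A = integral {0..2*pi} g"
  have contf: "continuous_on S f" for S
    using hol holomorphic_on_imp_continuous_on continuous_on_subset by blast
  have "continuous_on UNIV (\<lambda>t. f (cis t))"
    by (rule continuous_on_compose2[OF contf[of UNIV]]) (auto intro!: continuous_intros)
  then have contg: "continuous_on S g" for S
    unfolding g_def using a
    by (intro continuous_intros) (auto intro: continuous_on_subset simp: max_def)
  have int: "g integrable_on {u..v}" for u v
    by (rule integrable_continuous_real[OF contg])
  have per: "g (t + 2 * pi) = g t" for t
    by (simp add: g_def flip: cis_mult)
  \<comment> \<open>The two arguments of \<open>max\<close> are treated separately; here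
    \<open>g\<close> is bounded below pointwise by \<open>ln a\<close>.\<close>
  have "2 * pi * ln a \<le> A"
  proof -
    have "integral {0..2*pi} (\<lambda>_. ln a) \<le> A"
      unfolding A_def by (rule integral_le[OF _ int]) (use a in \<open>auto simp: g_def\<close>)
    then show ?thesis by simp
  qed
  moreover have "2 * pi * ln (cmod (f 0)) \<le> A" if f0: "f 0 \<noteq> 0"
  proof (rule field_le_epsilon)
    fix e' :: real assume "0 < e'"
    define e where "e = e' / (2 * pi)"
    have e: "0 < e" "e' = 2 * pi * e" using \<open>0 < e'\<close> by (auto simp: e_def)
    \<comment> \<open>Starting angles lie in [0, 2 pi) and each sum goes once round the circle, so
      all angles stay below 4 pi.\<close>
    have "uniformly_continuous_on {0..4*pi} g"
      by (intro compact_uniformly_continuous contg) auto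
    then obtain d where d: "0 < d"
      and unif: "\<And>u v. u \<in> {0..4*pi} \<Longrightarrow> v \<in> {0..4*pi} \<Longrightarrow> dist u v < d \<Longrightarrow> dist (g u) (g v) < e"
      using e unfolding uniformly_continuous_on_def by metis
    \<comment> \<open>So many rotations that the angle \<open>c\<close> between neighbours is below
      the modulus of continuity \<open>d\<close>.\<close>
    obtain m :: nat where m: "2 * pi / d < real m" using reals_Archimedean2 by blast
    have mpos: "0 < real m" using m d by (smt (verit) divide_pos_pos pi_gt_zero)
    define c where "c = 2 * pi / real m"
    have c: "0 < c" "c < d" "c * real m = 2 * pi"
      using m d mpos by (auto simp: c_def field_simps)
    define H where "H = (\<lambda>z. \<Prod>j<m. f (cis (c * real j) * z))"
    define L where "L = (A + 2 * pi * e) / c"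
    have fr: "cmod (H z) \<le> exp L" if "z \<in> frontier (cball 0 1)" for z
    proof -
      have "cmod z = 1" using that by simp
      define s where "s = Arg2pi z"
      have s: "0 \<le> s" "s < 2 * pi" "z = cis s"
        using Arg2pi[of z] \<open>cmod z = 1\<close> by (auto simp: s_def is_Arg_def cis_conv_exp)
      have "c * (\<Sum>j<m. g (s + c * real j)) \<le> integral {s..s + c * real m} g + c * real m * e"
      proof (rule riemann_sum_le_integral[OF int])
        fix u v assume "u \<in> {s..s + c * real m}" "v \<in> {s..s + c * real m}" "\<bar>u - v\<bar> \<le> c"
        then show "g u \<le> g v + e"
          using unif[of u v] c s by (auto simp: dist_real_def)
      qed (use c in auto)
      also have "integral {s..s + c * real m} g = A"
        unfolding A_def c(3) by (rule integral_periodic_shift[OF contg per]) (use s in auto)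
      finally have "(\<Sum>j<m. g (s + c * real j)) \<le> L"
        using c by (simp add: L_def field_simps)
      have "cmod (H z) = (\<Prod>j<m. cmod (f (cis (c * real j + s))))"
        by (simp add: H_def prod_norm s(3) cis_mult)
      also have "\<dots> \<le> (\<Prod>j<m. exp (g (s + c * real j)))"
      proof (rule prod_mono)
        fix j
        have "exp (g (s + c * real j)) = max (cmod (f (cis (s + c * real j)))) a"
          unfolding g_def using a by (intro exp_ln) auto
        then show "0 \<le> cmod (f (cis (c * real j + s))) \<and> cmod (f (cis (c * real j + s))) \<le> exp (g (s + c * real j))"
          by (simp add: add.commute)
      qed
      also have "\<dots> = exp (\<Sum>j<m. g (s + c * real j))"
        by (simp add: exp_sum)
      also have "\<dots> \<le> exp L" using \<open>_ \<le> L\<close> by simp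
      finally show ?thesis .
    qed
    have Hhol: "H holomorphic_on S" for S
      unfolding H_def
      by (intro holomorphic_intros holomorphic_on_compose_gen[OF _ hol, unfolded comp_def]) auto
    have "cmod (H 0) \<le> exp L"
      by (rule maximum_modulus_frontier[of H "cball 0 1"])
         (auto intro!: Hhol holomorphic_on_imp_continuous_on fr)
    \<comment> \<open>Every factor of \<open>H 0\<close> is \<open>f 0\<close>, so
      \<open>H 0\<close> is its \<open>m\<close>-th power; multiplying by \<open>c\<close> then
      turns \<open>m\<close> into 2 pi.\<close>
    then have "exp (real m * ln (cmod (f 0))) \<le> exp L"
      using f0 by (simp add: H_def norm_power exp_of_nat_mult)
    then have "real m * ln (cmod (f 0)) \<le> L" by simp
    then have "c * (real m * ln (cmod (f 0))) \<le> A + 2 * pi * e"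
      using c by (simp add: L_def field_simps)
    then show "2 * pi * ln (cmod (f 0)) \<le> A + e'"
      unfolding e using c(3) by (simp flip: mult.assoc)
  qed
  ultimately show ?thesis
    using a unfolding A_def[symmetric] g_def[symmetric]
    by (cases "f 0 = 0") (auto simp: max_def)
qed

text \<open>Nonpositivity kills the positive part of \<open>circle_integral\<close>; monotone
  convergence applied to the increasing functions \<open>- h n\<close> handles the negative
  part.\<close>

lemma circle_integral_decreasing_limit:
  fixes h :: "nat \<Rightarrow> real \<Rightarrow> real" and c :: "nat \<Rightarrow> real"
  assumes cont: "\<And>n. continuous_on UNIV (h n)" and dec: "\<And>n t. h (Suc n) t \<le> h n t"
    and nonpos: "\<And>n t. h n t \<le> 0"
    and mean: "\<And>n. 2 * pi * c n \<le> integral {0..2*pi} (h n)"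
  shows "(INF n. ereal (c n)) \<le> ereal (1 / (2*pi)) * circle_integral (\<lambda>t. INF n. ereal (h n t))"
proof -
  let ?c = "INF n. ereal (c n)" and ?g = "\<lambda>t. INF n. ereal (h n t)"
  have g0: "?g t \<le> 0" for t
    by (rule INF_lower2[of 0]) (use nonpos in auto)
  have pos: "e2ennreal (?g t) = 0" for t
    by (rule e2ennreal_neg[OF g0])
  have neg: "e2ennreal (- ?g t) = (SUP n. ennreal (- h n t))" for t
  proof -
    have "- ?g t = (SUP n. - ereal (h n t))"
      by (simp add: ereal_SUP_uminus_eq flip: uminus_ereal.simps)
    also have "e2ennreal \<dots> = (SUP n. e2ennreal (- ereal (h n t)))"
    proof (rule sup_continuousD)
      show "sup_continuous e2ennreal"
        by (rule sup_continuous_e2ennreal[OF sup_continuous_id])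
      show "incseq (\<lambda>n. - ereal (h n t))"
        using dec by (intro incseq_SucI) simp
    qed
    finally show ?thesis by (simp add: e2ennreal_ereal)
  qed
  have "(\<integral>\<^sup>+t\<in>{0..2*pi}. e2ennreal (- ?g t) \<partial>lborel)
      = (\<integral>\<^sup>+t. (SUP n. ennreal (- h n t) * indicator {0..2*pi} t) \<partial>lborel)"
    by (simp add: neg SUP_mult_right_ennreal)
  also have "\<dots> = (SUP n. \<integral>\<^sup>+t. ennreal (- h n t) * indicator {0..2*pi} t \<partial>lborel)"
  proof (rule nn_integral_monotone_convergence_SUP)
    show "incseq (\<lambda>n t. ennreal (- h n t) * indicator {0..2*pi} t)"
      using dec by (intro incseq_SucI le_funI mult_right_mono ennreal_leI) auto
    fix n
    have "h n \<in> borel_measurable borel"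
      by (rule borel_measurable_continuous_onI[OF cont])
    then show "(\<lambda>t. ennreal (- h n t) * indicator {0..2*pi} t) \<in> borel_measurable lborel"
      by measurable
  qed
  also have "\<dots> = (SUP n. ennreal (- integral {0..2*pi} (h n)))"
  proof (intro SUP_cong refl nn_integral_has_integral_lebesgue')
    fix n
    have "h n integrable_on {0..2*pi}"
      by (rule integrable_continuous_real) (rule continuous_on_subset[OF cont], simp)
    then show "((\<lambda>t. - h n t) has_integral - integral {0..2*pi} (h n)) {0..2*pi}"
      by (intro has_integral_neg integrable_integral)
  qed (use nonpos in auto)
  finally have I: "(\<integral>\<^sup>+t\<in>{0..2*pi}. e2ennreal (- ?g t) \<partial>lborel)
      = (SUP n. ennreal (- integral {0..2*pi} (h n)))" .
  show ?thesis
  proof (cases ?c)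
    case (real r)
    have le: "r \<le> c n" for n
      using INF_lower[of n UNIV "\<lambda>n. ereal (c n)"] by (simp add: real)
    have "integral {0..2*pi} (h n) \<le> integral {0..2*pi} (\<lambda>_. 0)" for n
      by (intro integral_le integrable_continuous_real continuous_on_subset[OF cont] nonpos) auto
    \<comment> \<open>The sign of \<open>r\<close> ensures that
      \<open>ennreal (2 * pi * - r)\<close> is not truncated to 0.\<close>
    then have r0: "r \<le> 0"
      using le[of 0] mean[of 0] integral_0 by (smt (verit) mult_pos_pos pi_gt_zero)
    have "(SUP n. ennreal (- integral {0..2*pi} (h n))) \<le> ennreal (2 * pi * - r)"
    proof (rule SUP_least)
      fix n
      have "2 * pi * r \<le> 2 * pi * c n" using le[of n] by (intro mult_left_mono) auto
      then show "ennreal (- integral {0..2*pi} (h n)) \<le> ennreal (2 * pi * - r)"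
        using mean[of n] by (intro ennreal_leI) linarith
    qed
    then have "enn2ereal (SUP n. ennreal (- integral {0..2*pi} (h n))) \<le> ereal (2 * pi * - r)"
      using r0 by (simp add: less_eq_ennreal.rep_eq mult_nonneg_nonpos)
    then have "ereal (2 * pi * r) \<le> circle_integral ?g"
      unfolding circle_integral_def I pos
      by (cases "enn2ereal (SUP n. ennreal (- integral {0..2*pi} (h n)))") (auto simp: zero_ennreal.rep_eq)
    then have "ereal (1 / (2*pi)) * ereal (2 * pi * r) \<le> ereal (1 / (2*pi)) * circle_integral ?g"
      by (intro ereal_mult_left_mono) auto
    then show ?thesis by (simp add: real)
  next
    case PInf
    then show ?thesis using INF_lower[of 0 UNIV "\<lambda>n. ereal (c n)"] by simp
  qed simp
qed


section \<open>Automorphisms, complex lines and the Kobayashi metric\<close>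

lemma holomorphic_map_on_subset:
  "holomorphic_map_on f T \<Longrightarrow> S \<subseteq> T \<Longrightarrow> holomorphic_map_on f S"
  by (auto simp: holomorphic_map_on_def)

lemma holomorphic_map_on_compose:
  assumes "holomorphic_map_on f S" "holomorphic_map_on g T" "f ` S \<subseteq> T"
  shows "holomorphic_map_on (\<lambda>z. g (f z)) S"
  unfolding holomorphic_map_on_def
proof
  fix z assume z: "z \<in> S"
  obtain D where D: "(f has_derivative D) (at z)" "\<And>c v. D (c *s v) = c *s D v"
    using assms(1) z unfolding holomorphic_map_on_def by blast
  obtain E where E: "(g has_derivative E) (at (f z))" "\<And>c v. E (c *s v) = c *s E v"
    using assms(2,3) z unfolding holomorphic_map_on_def by blast
  show "\<exists>D. ((\<lambda>z. g (f z)) has_derivative D) (at z) \<and> (\<forall>c v. D (c *s v) = c *s D v)"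
    using has_derivative_compose[OF D(1) E(1)] D(2) E(2)
    by (intro exI[of _ "\<lambda>h. E (D h)"]) auto
qed

lemma holomorphic_map_on_cong:
  assumes "holomorphic_map_on f S" "open S" "\<And>z. z \<in> S \<Longrightarrow> f z = g z"
  shows "holomorphic_map_on g S"
  using assms unfolding holomorphic_map_on_def
  by (metis (no_types, lifting) has_derivative_transform_within_open)

lemma holomorphic_map_on_imp_continuous_on:
  "holomorphic_map_on f S \<Longrightarrow> continuous_on S f"
  unfolding holomorphic_map_on_def
  by (metis continuous_at_imp_continuous_on has_derivative_continuous)

lemma holomorphic_map_on_scaleR:
  "holomorphic_map_on (\<lambda>z. c *\<^sub>R z) S"
  unfolding holomorphic_map_on_def
  by (auto intro!: exI[of _ "\<lambda>h. c *\<^sub>R h"] derivative_eq_intros simp: vec_eq_iff)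

section \<open>Automorphisms and their sublevel sets\<close>

lemma Aut0_D:
  assumes "f \<in> Aut0"
  shows "bij f" "holomorphic_map_on f UNIV" "holomorphic_map_on (inv f) UNIV" "f 0 = 0"
  using assms by (auto simp: Aut0_def biholomorphism_def)

lemma Aut0_compose:
  assumes "f \<in> Aut0" "g \<in> Aut0"
  shows "g \<circ> f \<in> Aut0"
proof -
  note f = Aut0_D[OF assms(1)] and g = Aut0_D[OF assms(2)]
  have "inv (g \<circ> f) = (\<lambda>z. inv f (inv g z))"
    using o_inv_distrib[OF g(1) f(1)] by (simp add: comp_def)
  then show ?thesis
    using bij_comp[OF f(1) g(1)] holomorphic_map_on_compose[OF f(2) g(2)]
      holomorphic_map_on_compose[OF g(3) f(3)] f(4) g(4)
    by (simp add: Aut0_def biholomorphism_def comp_def)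
qed

lemma Aut0_open_sublevel:
  assumes "f \<in> Aut0"
  shows "open {z. norm (f z) < r}"
  by (intro open_Collect_less continuous_intros)
     (use Aut0_D(2)[OF assms] holomorphic_map_on_imp_continuous_on in auto)

lemma Aut0_connected_sublevel:
  assumes "f \<in> Aut0"
  shows "connected {z. norm (f z) < r}"
proof -
  note f = Aut0_D[OF assms]
  have "{z. norm (f z) < r} = inv f ` ball 0 r"
  proof safe
    fix z assume "norm (f z) < r"
    then show "z \<in> inv f ` ball 0 r"
      using f(1) by (intro image_eqI[of _ _ "f z"]) (auto simp: bij_is_inj)
  qed (use f(1) in \<open>auto simp: bij_is_surj surj_f_inv_f\<close>)
  moreover have "continuous_on (ball 0 r) (inv f)"
    using holomorphic_map_on_imp_continuous_on[OF f(3)] continuous_on_subset by blast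
  ultimately show ?thesis
    using connected_continuous_image[of "ball 0 r" "inv f"] by simp
qed

text \<open>The rescaled map \<open>f / r\<close> carries the sublevel set onto the unit
  ball.\<close>

lemma Aut0_biholomorphic_sublevel:
  assumes f: "f \<in> Aut0" and r: "0 < r"
  shows "biholomorphic {z. norm (f z) < r} (ball 0 1)"
proof -
  let ?W = "{z. norm (f z) < r}"
  define g where "g z = (1 / r) *\<^sub>R f z" for z
  define h where "h w = inv f (r *\<^sub>R w)" for w
  note f' = Aut0_D[OF f]
  have hg: "h (g z) = z" and gh: "g (h w) = w" for z w
    using r f'(1) by (auto simp: g_def h_def bij_is_inj bij_is_surj surj_f_inv_f)
  have gW: "g z \<in> ball 0 1 \<longleftrightarrow> z \<in> ?W" for z
    using r by (simp add: g_def)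
  have hW: "h w \<in> ?W" if "w \<in> ball 0 1" for w
    using gW[of "h w"] that gh by simp
  have bij: "bij_betw g ?W (ball 0 1)"
  proof (rule bij_betw_byWitness[where f' = h])
    show "g ` ?W \<subseteq> ball 0 1" "h ` ball 0 1 \<subseteq> ?W"
      using gW hW by blast+
  qed (simp_all add: hg gh)
  have "holomorphic_map_on g ?W"
    unfolding g_def
    by (rule holomorphic_map_on_compose[OF holomorphic_map_on_subset[OF f'(2)]
          holomorphic_map_on_scaleR[of _ UNIV]]) auto
  moreover have "holomorphic_map_on h (ball 0 1)"
    unfolding h_def
    by (rule holomorphic_map_on_compose[OF holomorphic_map_on_scaleR f'(3)]) auto
  then have "holomorphic_map_on (inv_into ?W g) (ball 0 1)"
  proof (rule holomorphic_map_on_cong)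
    fix w :: "complex ^ 'a" assume w: "w \<in> ball 0 1"
    show "h w = inv_into ?W g w"
      using bij gh hW[OF w] by (metis bij_betw_imp_inj_on inv_into_f_f)
  qed simp
  ultimately show ?thesis
    unfolding biholomorphic_def biholomorphism_def
    using bij Aut0_open_sublevel[OF f] by blast
qed

section \<open>Restriction to complex lines\<close>

lemma has_derivative_complex_line:
  "((\<lambda>\<zeta>. z + \<zeta> *s w) has_derivative (\<lambda>h. h *s w)) (at \<zeta>\<^sub>0)" for z w :: "complex ^ 'k"
proof -
  have "bounded_linear (\<lambda>h. h *s w)"
    by (rule linear_conv_bounded_linear[THEN iffD1], rule linearI)
       (auto simp: vec_eq_iff algebra_simps)
  then have "((\<lambda>\<zeta>. \<zeta> *s w) has_derivative (\<lambda>h. h *s w)) (at \<zeta>\<^sub>0)"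
    by (rule bounded_linear_imp_has_derivative)
  then show ?thesis
    by (auto intro!: derivative_eq_intros)
qed

text \<open>Complex linearity gives \<open>D (h *s w) = h *s D w\<close>, which turns the real
  derivative along the line into a complex one.\<close>

lemma has_field_derivative_complex_line:
  fixes f :: "complex ^ 'k \<Rightarrow> complex ^ 'm"
  assumes "(f has_derivative D) (at (z + \<zeta>\<^sub>0 *s w))" "\<And>c v. D (c *s v) = c *s D v"
  shows "((\<lambda>\<zeta>. f (z + \<zeta> *s w) $ i) has_field_derivative (D w $ i)) (at \<zeta>\<^sub>0)"
proof -
  have "((\<lambda>\<zeta>. f (z + \<zeta> *s w)) has_derivative (\<lambda>h. D (h *s w))) (at \<zeta>\<^sub>0)"
    using has_derivative_compose[OF has_derivative_complex_line assms(1)] .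
  then have "((\<lambda>\<zeta>. f (z + \<zeta> *s w) $ i) has_derivative (\<lambda>h. D (h *s w) $ i)) (at \<zeta>\<^sub>0)"
    by (rule bounded_linear.has_derivative[OF bounded_linear_vec_nth])
  then show ?thesis
    by (simp add: has_field_derivative_def assms(2) mult_commute_abs)
qed

lemma holomorphic_on_complex_line:
  fixes f :: "complex ^ 'k \<Rightarrow> complex ^ 'm"
  assumes "holomorphic_map_on f UNIV"
  shows "(\<lambda>\<zeta>. f (z + \<zeta> *s w) $ i) holomorphic_on A"
proof (rule holomorphic_onI)
  fix \<zeta>\<^sub>0
  obtain D where "(f has_derivative D) (at (z + \<zeta>\<^sub>0 *s w))" "\<And>c v. D (c *s v) = c *s D v"
    using assms unfolding holomorphic_map_on_def by blast
  from has_field_derivative_complex_line[OF this]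
  show "(\<lambda>\<zeta>. f (z + \<zeta> *s w) $ i) field_differentiable at \<zeta>\<^sub>0 within A"
    using field_differentiable_at_within field_differentiable_def by blast
qed

lemma continuous_on_complex_line: "continuous_on A (\<lambda>\<zeta>. z + \<zeta> *s w)" for z w :: "complex ^ 'k"
  by (intro continuous_at_imp_continuous_on ballI has_derivative_continuous[OF has_derivative_complex_line])

lemma norm_scalar_mult: "norm (c *s v) = cmod c * norm v" for v :: "complex ^ 'k"
  by (simp add: norm_vec_def norm_mult L2_set_right_distrib)

text \<open>Every positive \<alpha> is admissible in the infimum: a disc with velocity
  \<xi>/\<alpha> at \<open>z\<close> is obtained by pulling back an affine disc whose velocity at
  \<open>G n z\<close> is small for large \<open>n\<close>.\<close>

lemma kobayashi_metric_eq_0: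
  fixes G :: "nat \<Rightarrow> complex ^ 'k \<Rightarrow> complex ^ 'k"
  assumes aut: "\<And>n. G n \<in> Aut0" and U: "open U" "z \<in> U"
    and bound: "\<And>n w. m \<le> n \<Longrightarrow> w \<in> U \<Longrightarrow> norm (G n w) \<le> e n" and e: "e \<longlonglongrightarrow> 0"
    and r: "0 < r" and sub: "\<And>n. m \<le> n \<Longrightarrow> {w. norm (G n w) < r} \<subseteq> \<Omega>"
  shows "kobayashi_metric \<Omega> z \<xi> = 0"
proof -
  define d where "d n i = deriv (\<lambda>\<zeta>. G n (z + \<zeta> *s \<xi>) $ i) 0" for n i
  have holG: "(\<lambda>\<zeta>. G n (z + \<zeta> *s \<xi>) $ i) holomorphic_on A" for n i A
    by (rule holomorphic_on_complex_line[OF Aut0_D(2)[OF aut]])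
  have d0: "(\<lambda>n. d n i) \<longlonglongrightarrow> 0" for i
  proof -
    have "open ((\<lambda>\<zeta>. z + \<zeta> *s \<xi>) -` U)"
      by (rule open_vimage[OF U(1) continuous_on_complex_line])
    \<comment> \<open>One radius for all \<open>n\<close>, so that Cauchy's inequality transfers the
      decay of \<open>e\<close> to the derivatives.\<close>
    then obtain \<rho> where \<rho>: "0 < \<rho>" "cball 0 \<rho> \<subseteq> (\<lambda>\<zeta>. z + \<zeta> *s \<xi>) -` U"
      using U(2) open_contains_cball_eq[rule_format, of "(\<lambda>\<zeta>. z + \<zeta> *s \<xi>) -` U" 0] by auto
    have "norm (d n i) \<le> e n / \<rho>" if "m \<le> n" for n
    proof -
      have "norm ((deriv ^^ 1) (\<lambda>\<zeta>. G n (z + \<zeta> *s \<xi>) $ i) 0) \<le> fact 1 * e n / \<rho> ^ 1"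
      proof (rule Cauchy_inequality)
        fix x :: complex assume "norm (0 - x) = \<rho>"
        then have "z + x *s \<xi> \<in> U" using \<rho>(2) by auto
        then have "norm (G n (z + x *s \<xi>)) \<le> e n" by (rule bound[OF that])
        then show "norm (G n (z + x *s \<xi>) $ i) \<le> e n"
          using Finite_Cartesian_Product.norm_nth_le order_trans by blast
      qed (use \<rho> holG holomorphic_on_imp_continuous_on in auto)
      then show ?thesis by (simp add: d_def)
    qed
    moreover have "(\<lambda>n. e n / \<rho>) \<longlonglongrightarrow> 0"
      using tendsto_divide[OF e tendsto_const[of \<rho>]] \<rho> by simp
    ultimately show ?thesis
      using Lim_null_comparison[OF eventually_sequentiallyI[of m "\<lambda>n. norm (d n i) \<le> e n / \<rho>"]] by blast
  qed
  have G0: "(\<lambda>n. G n z) \<longlonglongrightarrow> 0"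
    by (rule Lim_null_comparison[OF eventually_sequentiallyI[of m] e]) (rule bound[OF _ U(2)])
  have "\<exists>f. holomorphic_disc f \<Omega> \<and> f 0 = z \<and> \<alpha> *\<^sub>R (\<chi> i. deriv (\<lambda>\<zeta>. f \<zeta> $ i) 0) = \<xi>"
    if \<alpha>: "0 < \<alpha>" for \<alpha>
  proof -
    \<comment> \<open>The image of \<xi>/\<alpha> under the derivative of \<open>G n\<close> at
      \<open>z\<close>. Centre and velocity below \<open>r / 2\<close> keep the affine disc inside
      the ball of radius \<open>r\<close>.\<close>
    define \<eta> where "\<eta> n = (\<chi> i. d n i / of_real \<alpha>)" for n
    have "\<eta> \<longlonglongrightarrow> 0"
    proof (rule vec_tendstoI)
      fix i
      show "(\<lambda>n. \<eta> n $ i) \<longlonglongrightarrow> 0 $ i"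
        using tendsto_divide[OF d0[of i] tendsto_const[of "of_real \<alpha>"]] \<alpha> by (simp add: \<eta>_def)
    qed
    then have "\<forall>\<^sub>F n in sequentially. norm (\<eta> n) < r / 2"
      using r by (auto dest: tendstoD[of _ _ _ "r / 2"])
    moreover have "\<forall>\<^sub>F n in sequentially. norm (G n z) < r / 2"
      using r G0 by (auto dest: tendstoD[of _ _ _ "r / 2"])
    ultimately have "\<forall>\<^sub>F n in sequentially. norm (\<eta> n) < r / 2 \<and> norm (G n z) < r / 2 \<and> m \<le> n"
      using eventually_ge_at_top[of m] by eventually_elim simp
    then obtain n where n: "norm (\<eta> n) < r / 2" "norm (G n z) < r / 2" "m \<le> n"
      using eventually_happens'[OF sequentially_bot] by blast
    define g where "g = G n"
    define h where "h = inv g"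
    note aut' = Aut0_D[OF aut[of n], folded g_def, folded h_def]
    have hg: "h (g w) = w" and gh: "g (h w) = w" for w
      using aut'(1) by (auto simp: h_def bij_is_inj bij_is_surj surj_f_inv_f)
    obtain D where D: "(g has_derivative D) (at z)" "\<And>c v. D (c *s v) = c *s D v"
      using aut'(2) unfolding holomorphic_map_on_def by blast
    obtain E where E: "(h has_derivative E) (at (g z))" "\<And>c v. E (c *s v) = c *s E v"
      using aut'(3) unfolding holomorphic_map_on_def by blast
    have "((\<lambda>w. h (g w)) has_derivative (\<lambda>v. E (D v))) (at z)"
      by (rule has_derivative_compose[OF D(1) E(1)])
    then have "((\<lambda>w. w) has_derivative (\<lambda>v. E (D v))) (at z)"
      by (simp add: hg)
    \<comment> \<open>The derivative of the inverse undoes \<open>D\<close>, so the lifted disc has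
      velocity \<xi>/\<alpha>.\<close>
    then have ED: "E (D v) = v" for v
      using has_derivative_unique[OF has_derivative_ident] by metis
    have "D \<xi> $ i = d n i" for i
      using has_field_derivative_complex_line[of g D z 0 \<xi> i] D
      by (auto simp: d_def g_def intro!: DERIV_imp_deriv[symmetric])
    then have \<eta>: "\<eta> n = inverse (of_real \<alpha>) *s D \<xi>"
      by (simp add: \<eta>_def vec_eq_iff divide_inverse mult.commute)
    define f where "f \<zeta> = h (g z + \<zeta> *s \<eta> n)" for \<zeta>
    have "deriv (\<lambda>\<zeta>. f \<zeta> $ i) 0 = E (\<eta> n) $ i" for i
      unfolding f_def using has_field_derivative_complex_line[of h E "g z" 0 "\<eta> n" i] E
      by (intro DERIV_imp_deriv) auto
    moreover have "E (\<eta> n) = inverse (of_real \<alpha>) *s \<xi>"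
      by (simp add: \<eta> E(2) ED)
    ultimately have "\<alpha> *\<^sub>R (\<chi> i. deriv (\<lambda>\<zeta>. f \<zeta> $ i) 0) = \<xi>"
      using \<alpha> by (simp add: vec_eq_iff scaleR_conv_of_real[where 'a = complex] flip: mult.assoc)
    moreover have "f 0 = z" by (simp add: f_def hg)
    moreover have "holomorphic_disc f \<Omega>"
      unfolding holomorphic_disc_def
    proof (intro conjI allI)
      show "(\<lambda>\<zeta>. f \<zeta> $ i) holomorphic_on ball 0 1" for i
        unfolding f_def by (rule holomorphic_on_complex_line[OF aut'(3)])
      show "f ` ball 0 1 \<subseteq> \<Omega>"
      proof safe
        fix \<zeta> :: complex assume \<zeta>: "\<zeta> \<in> ball 0 1"
        have "norm (g (f \<zeta>)) \<le> norm (g z) + cmod \<zeta> * norm (\<eta> n)"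
          unfolding f_def gh norm_scalar_mult[symmetric] by (rule norm_triangle_ineq)
        also have "cmod \<zeta> * norm (\<eta> n) \<le> 1 * norm (\<eta> n)"
          using \<zeta> by (intro mult_right_mono) auto
        finally have "norm (g (f \<zeta>)) < r" using n by (simp add: g_def)
        then show "f \<zeta> \<in> \<Omega>" using sub[OF n(3)] by (auto simp: g_def)
      qed
    qed
    ultimately show ?thesis by blast
  qed
  then have "{\<alpha>. 0 < \<alpha> \<and> (\<exists>f. holomorphic_disc f \<Omega> \<and> f 0 = z \<and>
      \<alpha> *\<^sub>R (\<chi> i. deriv (\<lambda>\<zeta>. f \<zeta> $ i) 0) = \<xi>)} = {0<..}"
    by auto
  then show ?thesis
    by (simp add: kobayashi_metric_def)
qed


section \<open>The basin of the sequence\<close>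

lemma norm_vector_2: "norm (vector [u, v] :: complex ^ 2) = sqrt ((cmod u)\<^sup>2 + (cmod v)\<^sup>2)"
  by (simp add: norm_vec_def L2_set_def sum_2)

locale henon_sequence =
  fixes a :: "nat \<Rightarrow> real"
    and P :: "real poly"
    and F :: "nat \<Rightarrow> complex ^ 2 \<Rightarrow> complex ^ 2"
  assumes a_pos: "0 < a n"
    and a_lim: "(\<lambda>n. a n powr (2 powr (- real n))) \<longlonglongrightarrow> 0"
    and a_step: "0 < a (Suc n) \<and> a (Suc n) < (a n)\<^sup>2 \<and> (a n)\<^sup>2 < 1"
    and P_coeffs: "coeff P i \<ge> 0"
    and P_0: "poly P 0 > 0"
    and F_def: "F n z =
      vector [of_real (a n) * z $ 2 + (z $ 1)\<^sup>2 * poly (map_poly of_real P) (z $ 1),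
              of_real (a n) * z $ 1]"
begin

section \<open>Estimates for the polynomial and the sequence \<open>a\<close>\<close>

lemma poly_of_real_eq: "poly (map_poly of_real P) (of_real t :: complex) = of_real (poly P t)"
  by (simp add: poly_altdef degree_map_poly coeff_map_poly)

lemma poly_mono: "0 \<le> s \<Longrightarrow> s \<le> t \<Longrightarrow> poly P s \<le> poly P t"
  unfolding poly_altdef by (intro sum_mono mult_left_mono power_mono P_coeffs)

lemma norm_poly_le:
  fixes x :: complex
  assumes "cmod x \<le> 1"
  shows "cmod (poly (map_poly of_real P) x) \<le> poly P 1"
proof -
  have "cmod (poly (map_poly of_real P) x) \<le> (\<Sum>i\<le>degree P. coeff P i * cmod x ^ i)"
    unfolding poly_altdef
    by (rule sum_norm_le[THEN order_trans])
       (auto simp: degree_map_poly coeff_map_poly norm_mult norm_power P_coeffs)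
  also have "\<dots> = poly P (cmod x)" by (simp add: poly_altdef)
  also have "\<dots> \<le> poly P 1" using assms by (intro poly_mono) auto
  finally show ?thesis .
qed

lemma poly_1_pos: "0 < poly P 1"
  using P_0 poly_mono[of 0 1] by simp

lemma a_less_1: "a n < 1"
  using a_step[of n] a_pos[of n] by (simp add: power2_less_1_iff)

lemma a_Suc_le: "a (Suc n) \<le> (a n)\<^sup>2"
  using a_step[of n] by simp

lemma a_tendsto_0: "a \<longlonglongrightarrow> 0"
proof -
  have dec: "a n \<le> a 0" for n
  proof (induction n)
    case (Suc n)
    have "a n * a n \<le> a n * 1" using a_less_1[of n] a_pos[of n] by (intro mult_left_mono) auto
    then show ?case using Suc a_Suc_le[of n] by (simp add: power2_eq_square)
  qed simp
  \<comment> \<open>Bounding one factor of the square by \<open>a 0\<close> gives geometric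
    decay.\<close>
  have "a n \<le> a 0 ^ Suc n" for n
  proof (induction n)
    case (Suc n)
    have "a (Suc n) \<le> a n * a n" using a_Suc_le[of n] by (simp add: power2_eq_square)
    also have "\<dots> \<le> a 0 * a 0 ^ Suc n"
      using dec[of n] Suc a_pos less_imp_le by (intro mult_mono) auto
    finally show ?case by simp
  qed simp
  then have "norm (a n) \<le> a 0 ^ Suc n" for n
    using a_pos[of n] by simp
  then have "\<forall>\<^sub>F n in sequentially. norm (a n) \<le> a 0 ^ Suc n"
    by (rule always_eventually[OF allI])
  moreover have "(\<lambda>n. a 0 ^ Suc n) \<longlonglongrightarrow> 0"
    using a_pos[of 0] a_less_1[of 0] by (intro LIMSEQ_Suc[OF LIMSEQ_power_zero]) simp
  ultimately show ?thesis
    by (rule Lim_null_comparison)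
qed

section \<open>The compositions and their contraction near the origin\<close>

definition G :: "nat \<Rightarrow> complex ^ 2 \<Rightarrow> complex ^ 2" where "G = iterate_seq F"

lemma G_0: "G 0 z = F 0 z" and G_Suc: "G (Suc n) z = F (Suc n) (G n z)"
  by (simp_all add: G_def)

lemma F_Aut0: "F n \<in> Aut0"
proof -
  have "F n = (\<lambda>z. vector [of_real (a n) * z $ 2 + (z $ 1)\<^sup>2 * poly (map_poly of_real P) (z $ 1),
            of_real (a n) * z $ 1])"
    by (simp add: fun_eq_iff F_def)
  then show ?thesis using henon_map_in_Aut0[OF a_pos] by simp
qed

lemma G_Aut0: "G n \<in> Aut0"
  unfolding G_def by (induction n) (auto simp del: o_apply simp: F_Aut0 intro!: Aut0_compose)

text \<open>\<open>P(1) r \<le> 1/2\<close> makes \<open>F n\<close> contract the ball of radius \<open>r\<close> once \<open>a n \<le> 1/4\<close>, and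
  \<open>(1 + P(1)) r < 1\<close> makes the plurisubharmonic function below nonpositive.\<close>

definition r :: real where "r = 1 / (2 * (1 + poly P 1))"

lemma r_bounds: "0 < r" "r < 1" "poly P 1 * r \<le> 1 / 2" "(1 + poly P 1) * r < 1"
  using poly_1_pos by (auto simp: r_def field_simps)

text \<open>The bound by \<open>r\<close> serves \<open>V_nonpos\<close>, where \<open>a n\<close>
  is one of the arguments of \<open>max\<close>.\<close>

definition N :: nat where "N = (SOME N. \<forall>n\<ge>N. a n \<le> min (1 / 4) r)"

lemma a_le: "N \<le> n \<Longrightarrow> a n \<le> 1 / 4" "N \<le> n \<Longrightarrow> a n \<le> r"
proof -
  have "\<forall>\<^sub>F n in sequentially. a n < min (1 / 4) r"
    by (rule order_tendstoD(2)[OF a_tendsto_0]) (use r_bounds in auto)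
  then have "\<exists>N. \<forall>n\<ge>N. a n \<le> min (1 / 4) r"
    unfolding eventually_sequentially using less_imp_le by blast
  then have "\<forall>n\<ge>N. a n \<le> min (1 / 4) r"
    unfolding N_def by (rule someI_ex)
  then show "N \<le> n \<Longrightarrow> a n \<le> 1 / 4" "N \<le> n \<Longrightarrow> a n \<le> r" by auto
qed

text \<open>The linear part is \<open>a n\<close> times the coordinate swap, an isometry, and
  contributes at most 1/4; the quadratic part contributes at most \<open>r * poly P 1\<close>, hence
  1/2.\<close>

lemma F_contracts:
  assumes n: "N \<le> n" and z: "norm z < r"
  shows "norm (F n z) \<le> 3 / 4 * norm z"
proof -
  have z1: "cmod (z $ 1) \<le> norm z" by (rule Finite_Cartesian_Product.norm_nth_le)
  have nz: "norm z = sqrt ((cmod (z $ 1))\<^sup>2 + (cmod (z $ 2))\<^sup>2)"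
    by (simp add: norm_vec_def L2_set_def sum_2)
  define Q where "Q = (z $ 1)\<^sup>2 * poly (map_poly of_real P) (z $ 1)"
  have "F n z = a n *\<^sub>R vector [z $ 2, z $ 1] + vector [Q, 0]"
    by (simp add: F_def Q_def vec_eq_iff forall_2 scaleR_conv_of_real[where 'a = complex])
  then have "norm (F n z)
      \<le> norm (a n *\<^sub>R vector [z $ 2, z $ 1] :: complex ^ 2) + norm (vector [Q, 0] :: complex ^ 2)"
    using norm_triangle_ineq by metis
  also have "norm (a n *\<^sub>R vector [z $ 2, z $ 1] :: complex ^ 2) = a n * norm z"
    using a_pos[of n] by (simp add: norm_vector_2 nz add.commute)
  also have "a n * norm z \<le> 1 / 4 * norm z"
    using a_le(1)[OF n] by (intro mult_right_mono) auto
  also have "norm (vector [Q, 0] :: complex ^ 2)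
      = cmod (z $ 1) * (cmod (z $ 1) * cmod (poly (map_poly of_real P) (z $ 1)))"
    by (simp add: norm_vector_2 Q_def norm_mult power2_eq_square)
  also have "\<dots> \<le> norm z * (r * poly P 1)"
    using z1 z r_bounds norm_poly_le[of "z $ 1"] by (intro mult_mono) auto
  also have "\<dots> \<le> norm z * (1 / 2)"
    using r_bounds by (intro mult_left_mono) (auto simp: mult.commute)
  finally show ?thesis by simp
qed

definition W :: "nat \<Rightarrow> (complex ^ 2) set" where "W n = {z. norm (G n z) < r}"

lemma W_decay:
  assumes "N \<le> m" "m \<le> n" "z \<in> W m"
  shows "norm (G n z) \<le> (3 / 4) ^ (n - m) * norm (G m z)"
  using assms(2)
proof (induction n rule: dec_induct)
  case (step n)
  \<comment> \<open>The decay so far keeps the orbit in the ball of radius \<open>r\<close>, where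
    the next map contracts.\<close>
  have "(3 / 4) ^ (n - m) * norm (G m z) \<le> 1 * norm (G m z)"
    by (intro mult_right_mono power_le_one) auto
  then have "norm (G n z) < r" using step assms(3) by (simp add: W_def)
  then have "norm (G (Suc n) z) \<le> 3 / 4 * norm (G n z)"
    unfolding G_Suc using assms(1) step by (intro F_contracts) auto
  also have "\<dots> \<le> 3 / 4 * ((3 / 4) ^ (n - m) * norm (G m z))"
    using step by (intro mult_left_mono) auto
  finally show ?case using step by (simp add: Suc_diff_le)
qed simp

lemma W_decay_bound:
  assumes "N \<le> m" "m \<le> n" "z \<in> W m"
  shows "norm (G n z) \<le> (3 / 4) ^ (n - m) * r"
  using W_decay[OF assms] assms(3)
  by (elim order_trans) (intro mult_left_mono, auto simp: W_def)

lemma W_mono: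
  assumes "N \<le> m" "m \<le> n"
  shows "W m \<subseteq> W n"
proof
  fix z assume z: "z \<in> W m"
  have "(3 / 4) ^ (n - m) * norm (G m z) \<le> 1 * norm (G m z)"
    by (intro mult_right_mono power_le_one) auto
  then show "z \<in> W n" using W_decay[OF assms z] z by (simp add: W_def)
qed

lemma decay_tendsto_0: "(\<lambda>n. (3 / 4) ^ (n - m) * r) \<longlonglongrightarrow> 0"
  by (rule LIMSEQ_offset[of _ m]) (auto intro!: tendsto_mult_left_zero LIMSEQ_power_zero)

text \<open>An orbit inside the ball of radius \<open>r\<close> at some time from \<open>N\<close>
  on converges geometrically; the shift by \<open>N\<close> also makes the union increasing.\<close>

lemma basin_eq: "basin F = (\<Union>n. W (n + N))"
proof (intro equalityI subsetI)
  fix z assume "z \<in> basin F"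
  then have "(\<lambda>n. G n z) \<longlonglongrightarrow> 0" by (simp add: basin_def G_def)
  then have "\<forall>\<^sub>F n in sequentially. norm (G n z) < r"
    using r_bounds(1) by (auto dest: tendstoD[of _ _ _ r])
  then obtain k where "\<forall>n\<ge>k. norm (G n z) < r" unfolding eventually_sequentially by blast
  then have "z \<in> W (k + N)" by (simp add: W_def)
  then show "z \<in> (\<Union>n. W (n + N))" by blast
next
  fix z assume "z \<in> (\<Union>n. W (n + N))"
  then obtain k where k: "z \<in> W (k + N)" by blast
  have "(\<lambda>n. G n z) \<longlonglongrightarrow> 0"
    by (rule Lim_null_comparison[OF eventually_sequentiallyI[of "k + N"] decay_tendsto_0[of "k + N"]])
       (rule W_decay_bound[OF _ _ k], auto)
  then show "z \<in> basin F" by (simp add: basin_def G_def)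
qed

lemma W_subset_basin: "N \<le> n \<Longrightarrow> W n \<subseteq> basin F"
  unfolding basin_eq using le_add_diff_inverse2[of N n] by (metis UN_upper UNIV_I)

lemma basinE:
  assumes "z \<in> basin F"
  obtains m where "N \<le> m" "z \<in> W m"
  using assms that[OF le_add2] unfolding basin_eq by blast

section \<open>Topology and Kobayashi metric of the basin\<close>

lemma open_W: "open (W n)"
  unfolding W_def by (rule Aut0_open_sublevel[OF G_Aut0])

lemma zero_in_W: "0 \<in> W n"
  using Aut0_D(4)[OF G_Aut0[of n]] r_bounds by (simp add: W_def)

lemma open_basin: "open (basin F)"
  unfolding basin_eq using open_W by blast

lemma zero_in_basin: "0 \<in> basin F"
  unfolding basin_eq using zero_in_W by blast

lemma connected_basin: "connected (basin F)"
  unfolding basin_eq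
proof (rule connected_Union)
  show "connected S" if "S \<in> range (\<lambda>n. W (n + N))" for S
    using that Aut0_connected_sublevel[OF G_Aut0] by (auto simp: W_def)
  show "\<Inter> (range (\<lambda>n. W (n + N))) \<noteq> {}"
    using zero_in_W by blast
qed

lemma kobayashi_basin:
  assumes "z \<in> basin F"
  shows "kobayashi_metric (basin F) z \<xi> = 0"
proof -
  obtain m where m: "N \<le> m" "z \<in> W m" using assms by (rule basinE)
  show ?thesis
  proof (rule kobayashi_metric_eq_0[OF G_Aut0 open_W m(2) _ decay_tendsto_0 r_bounds(1)])
    show "norm (G n w) \<le> (3 / 4) ^ (n - m) * r" if "m \<le> n" "w \<in> W m" for n w
      by (rule W_decay_bound[OF m(1) that])
    show "{w. norm (G n w) < r} \<subseteq> basin F" if "m \<le> n" for n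
      using W_subset_basin[of n] m(1) that by (simp add: W_def)
  qed
qed

text \<open>Nonnegative coefficients preserve nonnegative real points, and
  \<open>poly P 0 * x\<close> is at least squared at each step. The exponent has
  \<open>Suc n\<close> because \<open>G n\<close> composes \<open>n + 1\<close> maps.\<close>

lemma real_orbit:
  assumes "0 \<le> s"
  shows "\<exists>x y. 0 \<le> x \<and> 0 \<le> y \<and> G n (vector [of_real s, 0]) = vector [of_real x, of_real y] \<and>
    (poly P 0 * s) ^ (2 ^ Suc n) \<le> poly P 0 * x"
proof (induction n)
  \<comment> \<open>Drop the nonnegative term \<open>a n * y\<close> and use
    \<open>poly P 0 \<le> poly P x\<close>.\<close>
  have step: "(poly P 0 * x)\<^sup>2 \<le> poly P 0 * (a n * y + x\<^sup>2 * poly P x)" "0 \<le> a n * y + x\<^sup>2 * poly P x"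
    if "0 \<le> x" "0 \<le> y" for x y n
  proof -
    have "poly P 0 \<le> poly P x" using that by (intro poly_mono) auto
    then have "x\<^sup>2 * poly P 0 \<le> x\<^sup>2 * poly P x" by (intro mult_left_mono) auto
    moreover have "0 \<le> x\<^sup>2 * poly P 0" using P_0 by simp
    moreover have "0 \<le> a n * y" using that a_pos[of n] by simp
    ultimately have *: "x\<^sup>2 * poly P 0 \<le> a n * y + x\<^sup>2 * poly P x"
      "0 \<le> a n * y + x\<^sup>2 * poly P x" by linarith+
    then show "0 \<le> a n * y + x\<^sup>2 * poly P x" by simp
    have "poly P 0 * (x\<^sup>2 * poly P 0) \<le> poly P 0 * (a n * y + x\<^sup>2 * poly P x)"
      using * P_0 by (intro mult_left_mono) auto
    then show "(poly P 0 * x)\<^sup>2 \<le> poly P 0 * (a n * y + x\<^sup>2 * poly P x)"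
      by (simp add: power2_eq_square algebra_simps)
  qed
  have F_real: "F n (vector [of_real x, of_real y])
      = vector [of_real (a n * y + x\<^sup>2 * poly P x), of_real (a n * x)]" for n x y
    by (simp add: F_def poly_of_real_eq)
  {
    case 0
    show ?case
      using step[of s 0 0] F_real[of 0 s 0] assms a_pos[of 0]
      by (intro exI[of _ "a 0 * 0 + s\<^sup>2 * poly P s"] exI[of _ "a 0 * s"])
         (auto simp: G_0 power2_eq_square)
  next
    case (Suc n)
    then obtain x y where xy: "0 \<le> x" "0 \<le> y" "G n (vector [of_real s, 0]) = vector [of_real x, of_real y]"
      "(poly P 0 * s) ^ (2 ^ Suc n) \<le> poly P 0 * x" by blast
    have "(poly P 0 * s) ^ (2 ^ Suc (Suc n)) = ((poly P 0 * s) ^ (2 ^ Suc n))\<^sup>2"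
      by (simp add: power_mult[symmetric] mult.commute)
    also have "\<dots> \<le> (poly P 0 * x)\<^sup>2"
      using xy P_0 assms by (intro power_mono) auto
    also have "\<dots> \<le> poly P 0 * (a (Suc n) * y + x\<^sup>2 * poly P x)"
      by (rule step(1)[OF xy(1,2)])
    finally show ?case
      using step(2)[OF xy(1,2), of "Suc n"] xy a_pos[of "Suc n"] F_real[of "Suc n" x y]
      by (intro exI[of _ "a (Suc n) * y + x\<^sup>2 * poly P x"] exI[of _ "a (Suc n) * x"])
         (simp add: G_Suc)
  }
qed

text \<open>At \<open>s = 1 / poly P 0\<close> the squared quantity starts at 1, so the first
  coordinate never falls below \<open>1 / poly P 0\<close>.\<close>

lemma basin_not_UNIV: "basin F \<noteq> UNIV"
proof
  let ?c = "poly P 0" and ?z = "vector [of_real (1 / poly P 0), 0] :: complex ^ 2"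
  assume "basin F = UNIV"
  then have "(\<lambda>n. G n ?z) \<longlonglongrightarrow> 0"
    unfolding basin_def G_def by blast
  then have "\<forall>\<^sub>F n in sequentially. norm (G n ?z) < 1 / ?c"
    using P_0 by (auto dest: tendstoD[of _ _ _ "1 / ?c"])
  then obtain n where n: "norm (G n ?z) < 1 / ?c"
    using eventually_happens'[OF sequentially_bot] by blast
  obtain x y where xy: "0 \<le> x"
    "G n ?z = vector [of_real x, of_real y]" "(?c * (1 / ?c)) ^ (2 ^ Suc n) \<le> ?c * x"
    using real_orbit[of "1 / ?c" n] P_0 by auto
  have "1 / ?c \<le> x" using xy(3) P_0 by (simp add: field_simps)
  also have "x = cmod (G n ?z $ 1)" using xy by simp
  also have "\<dots> \<le> norm (G n ?z)" by (rule Finite_Cartesian_Product.norm_nth_le)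
  finally show False using n by simp
qed


subsection \<open>The plurisubharmonic function\<close>

text \<open>The estimate \<open>max \<bar>x (n + 1)\<bar> (a (n + 1)) \<le> exp K * (max \<bar>x n\<bar> (a n))\<^sup>2\<close> on \<open>W n\<close> makes \<open>V n\<close>
  decreasing in \<open>n\<close>.\<close>

definition K :: real where "K = ln (1 + poly P 1)"

text \<open>The maximum with \<open>a n\<close> keeps \<open>V n\<close> finite and continuous at
  zeros of the first coordinate.\<close>

definition V :: "nat \<Rightarrow> complex ^ 2 \<Rightarrow> real" where
  "V n z = (ln (max (cmod (G n z $ 1)) (a n)) + K) / 2 ^ n"

text \<open>The lower limit is defined everywhere; on the basin the sequence eventually decreases,
  from an index depending on \<open>z\<close>.\<close>

definition u :: "complex ^ 2 \<Rightarrow> ereal" where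
  "u z = liminf (\<lambda>n. ereal (V n z))"

lemma K_nonneg: "0 \<le> K"
  using poly_1_pos by (simp add: K_def)

lemma V_Suc_le:
  assumes n: "N \<le> n" and z: "z \<in> W n"
  shows "V (Suc n) z \<le> V n z"
proof -
  define x y M where "x = G n z $ 1" and "y = G n z $ 2" and "M = max (cmod x) (a n)"
  have M: "0 < M" "cmod x \<le> M" "a n \<le> M" using a_pos[of n] by (auto simp: M_def)
  have le1: "cmod x \<le> 1" "cmod y \<le> 1"
    using z r_bounds(2) Finite_Cartesian_Product.norm_nth_le[of "G n z" 1]
      Finite_Cartesian_Product.norm_nth_le[of "G n z" 2]
    unfolding x_def y_def W_def by auto
  have "(a n)\<^sup>2 \<le> M\<^sup>2" using M a_pos[of n] by (intro power_mono) auto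
  \<comment> \<open>This makes the linear term quadratic in \<open>M\<close>, and also bounds the
    new second argument of \<open>max\<close>.\<close>
  then have aM: "a (Suc n) \<le> M\<^sup>2" using a_Suc_le[of n] by linarith
  have "G (Suc n) z $ 1 = of_real (a (Suc n)) * y + x\<^sup>2 * poly (map_poly of_real P) x"
    by (simp add: G_Suc F_def x_def y_def)
  then have "cmod (G (Suc n) z $ 1)
      \<le> cmod (of_real (a (Suc n)) * y) + cmod (x\<^sup>2 * poly (map_poly of_real P) x)"
    by (simp add: norm_triangle_ineq)
  also have "\<dots> = a (Suc n) * cmod y + (cmod x)\<^sup>2 * cmod (poly (map_poly of_real P) x)"
    using a_pos[of "Suc n"] by (simp add: norm_mult norm_power)
  also have "\<dots> \<le> M\<^sup>2 * 1 + M\<^sup>2 * poly P 1"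
    using aM M le1 norm_poly_le[OF le1(1)]
    by (intro add_mono mult_mono power_mono) auto
  also have "\<dots> = (1 + poly P 1) * M\<^sup>2" by (simp add: algebra_simps)
  finally have "cmod (G (Suc n) z $ 1) \<le> (1 + poly P 1) * M\<^sup>2" .
  moreover have "1 * M\<^sup>2 \<le> (1 + poly P 1) * M\<^sup>2"
    using poly_1_pos by (intro mult_right_mono) auto
  ultimately have "ln (max (cmod (G (Suc n) z $ 1)) (a (Suc n))) \<le> ln ((1 + poly P 1) * M\<^sup>2)"
    using aM a_pos[of "Suc n"] by (intro ln_mono) (auto simp: max_def)
  also have "\<dots> = K + 2 * ln M"
    using M poly_1_pos by (simp add: K_def ln_mult ln_realpow)
  \<comment> \<open>The \<open>K\<close> of the estimate and the \<open>K\<close> inside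
    \<open>V (Suc n)\<close> add up to \<open>2 * K\<close>; this is why \<open>V\<close> carries
    the summand \<open>K\<close>.\<close>
  finally have "V (Suc n) z \<le> 2 * (ln M + K) / 2 ^ Suc n"
    unfolding V_def by (intro divide_right_mono) auto
  also have "\<dots> = V n z"
    unfolding V_def M_def x_def power_Suc by (rule mult_divide_mult_cancel_left) simp
  finally show ?thesis .
qed

lemma V_nonpos:
  assumes n: "N \<le> n" and z: "z \<in> W n"
  shows "V n z \<le> 0"
proof -
  have "max (cmod (G n z $ 1)) (a n) \<le> r"
    using z a_le(2)[OF n] Finite_Cartesian_Product.norm_nth_le[of "G n z" 1] by (auto simp: W_def)
  then have "ln (max (cmod (G n z $ 1)) (a n)) \<le> ln r"
    using a_pos[of n] by (intro ln_mono) auto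
  moreover have "ln r + K = ln ((1 + poly P 1) * r)"
    using r_bounds(1) poly_1_pos by (simp add: K_def ln_mult)
  moreover have "ln ((1 + poly P 1) * r) \<le> 0"
    using r_bounds poly_1_pos by (subst ln_le_zero_iff) auto
  ultimately show ?thesis by (simp add: V_def divide_nonpos_pos)
qed

lemma continuous_on_V: "continuous_on S (V n)"
proof -
  have "continuous_on UNIV (G n)"
    by (rule holomorphic_map_on_imp_continuous_on[OF Aut0_D(2)[OF G_Aut0]])
  then have "continuous_on S (G n)" using continuous_on_subset by blast
  then show ?thesis
    unfolding V_def using a_pos[of n]
    by (intro continuous_intros) (auto simp: max_def)
qed

lemma V_mean_value:
  "2 * pi * V n z \<le> integral {0..2*pi} (\<lambda>t. V n (z + cis t *s w))"
proof -
  define g where "g t = ln (max (cmod (G n (z + cis t *s w) $ 1)) (a n))" for t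
  have "continuous_on {0..2*pi} (\<lambda>t. V n (z + cis t *s w))"
    by (rule continuous_on_compose2[OF continuous_on_V[of UNIV]],
        rule continuous_on_compose2[OF continuous_on_complex_line[of UNIV]])
       (auto intro!: continuous_intros)
  \<comment> \<open>This expression is \<open>g\<close>, recovered from \<open>V\<close>.\<close>
  then have "continuous_on {0..2*pi} (\<lambda>t. V n (z + cis t *s w) * 2 ^ n - K)"
    by (intro continuous_intros)
  then have int: "g integrable_on {0..2*pi}"
    by (intro integrable_continuous_real) (simp add: g_def V_def)
  have "2 * pi * ln (max (cmod (G n (z + 0 *s w) $ 1)) (a n)) \<le> integral {0..2*pi} g"
    unfolding g_def
    by (rule ln_max_mean_value[OF holomorphic_on_complex_line[OF Aut0_D(2)[OF G_Aut0]] a_pos])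
  moreover have "integral {0..2*pi} (\<lambda>t. (g t + K) / 2 ^ n) = (integral {0..2*pi} g + 2 * pi * K) / 2 ^ n"
    using Henstock_Kurzweil_Integration.integral_add[OF int integrable_const_ivl[of K]] by simp
  ultimately show ?thesis
    by (simp add: V_def g_def[symmetric] field_simps)
qed

lemma V_mono:
  assumes "N \<le> m" "m \<le> n" "z \<in> W m"
  shows "V (Suc n) z \<le> V n z" "V n z \<le> 0"
  using assms W_mono[OF assms(1,2)] by (auto intro!: V_Suc_le V_nonpos)

lemma u_eq_INF:
  assumes "N \<le> m" "z \<in> W m"
  shows "u z = (INF n. ereal (V (n + m) z))"
proof -
  have "decseq (\<lambda>n. ereal (V (n + m) z))"
    using V_mono(1)[OF assms(1) _ assms(2)] by (intro decseq_SucI) simp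
  then have "liminf (\<lambda>n. ereal (V (n + m) z)) = (INF n. ereal (V (n + m) z))"
    by (intro lim_imp_Liminf LIMSEQ_INF) auto
  then show ?thesis
    using liminf_shift_k[of "\<lambda>n. ereal (V n z)" m] by (simp add: u_def)
qed

lemma u_le_V:
  assumes "N \<le> m" "m \<le> n" "z \<in> W m"
  shows "u z \<le> ereal (V n z)"
  unfolding u_eq_INF[OF assms(1,3)] by (rule INF_lower2[of "n - m"]) (use assms in auto)

lemma u_nonpos:
  assumes "z \<in> basin F"
  shows "u z \<le> 0"
proof -
  obtain m where m: "N \<le> m" "z \<in> W m" using assms by (rule basinE)
  have "u z \<le> ereal (V m z)" by (rule u_le_V[OF m(1) order_refl m(2)])
  also have "\<dots> \<le> 0" using V_nonpos[OF m] by simp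
  finally show ?thesis .
qed

text \<open>By compactness a single \<open>m\<close> serves the whole disc, so the
  \<open>V n\<close> with \<open>n \<ge> m\<close> decrease at all its points
  simultaneously.\<close>

lemma circle_subset_W:
  assumes "\<forall>\<zeta>\<in>cball 0 1. z + \<zeta> *s w \<in> basin F"
  obtains m where "N \<le> m" "\<forall>\<zeta>\<in>cball 0 1. z + \<zeta> *s w \<in> W m"
proof -
  let ?S = "(\<lambda>\<zeta>. z + \<zeta> *s w) ` cball 0 1"
  have "compact ?S"
    by (intro compact_continuous_image continuous_on_complex_line compact_cball)
  moreover have "?S \<subseteq> (\<Union>n\<in>UNIV. W (n + N))"
    using assms by (auto simp: basin_eq)
  ultimately obtain C where C: "finite C" "?S \<subseteq> (\<Union>n\<in>C. W (n + N))"
    by (rule compactE_image[OF _ open_W])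
  obtain k where k: "C \<subseteq> {..k}"
    using C(1) finite_nat_iff_bounded_le by blast
  have "(\<Union>n\<in>C. W (n + N)) \<subseteq> W (k + N)"
    using k by (intro UN_least W_mono) auto
  then have "?S \<subseteq> W (k + N)"
    using C(2) by (rule order_trans[rotated])
  then show ?thesis
    unfolding image_subset_iff using that[of "k + N"] by simp
qed

lemma plurisubharmonic_on_u: "plurisubharmonic_on u (basin F)"
  unfolding plurisubharmonic_on_def
proof (intro conjI allI impI ballI)
  show "u z < \<infinity>" if "z \<in> basin F" for z
    using u_nonpos[OF that] by (auto simp: less_top[symmetric])
next
  fix c
  have "\<exists>T. open T \<and> z \<in> T \<and> T \<subseteq> {z \<in> basin F. u z < c}" if z: "z \<in> basin F" "u z < c" for z
  proof -
    obtain m where m: "N \<le> m" "z \<in> W m" using z(1) by (rule basinE)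
    \<comment> \<open>One term of the infimum is already below \<open>c\<close>; it is continuous
      and dominates \<open>u\<close> on \<open>W m\<close>, which gives a neighbourhood.\<close>
    obtain n where n: "ereal (V (n + m) z) < c"
      using z(2) unfolding u_eq_INF[OF m] INF_less_iff by blast
    have "open {w. ereal (V (n + m) w) < c}"
      by (intro open_Collect_less continuous_on_ereal continuous_on_V continuous_on_const)
    moreover have "u w < c" if "w \<in> W m" "ereal (V (n + m) w) < c" for w
      using u_le_V[OF m(1) _ that(1), of "n + m"] that(2) by simp
    ultimately show ?thesis
      using m n open_W W_subset_basin[OF m(1)]
      by (intro exI[of _ "W m \<inter> {w. ereal (V (n + m) w) < c}"]) auto
  qed
  then have "open {z \<in> basin F. u z < c}"
    by (subst open_subopen) blast
  then show "openin (top_of_set (basin F)) {z \<in> basin F. u z < c}"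
    by (rule open_subset[rotated]) auto
next
  fix z w :: "complex ^ 2"
  assume "\<forall>\<zeta>\<in>cball 0 1. z + \<zeta> *s w \<in> basin F"
  then obtain m where m: "N \<le> m" and W: "\<forall>\<zeta>\<in>cball 0 1. z + \<zeta> *s w \<in> W m"
    by (rule circle_subset_W)
  have Wt: "z + cis t *s w \<in> W m" for t using W by simp
  have "(INF n. ereal (V (n + m) z))
      \<le> ereal (1 / (2*pi)) * circle_integral (\<lambda>t. INF n. ereal (V (n + m) (z + cis t *s w)))"
  proof (rule circle_integral_decreasing_limit)
    show "continuous_on UNIV (\<lambda>t. V (n + m) (z + cis t *s w))" for n
      by (rule continuous_on_compose2[OF continuous_on_V[of UNIV]],
        rule continuous_on_compose2[OF continuous_on_complex_line[of UNIV]])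
         (auto intro!: continuous_intros)
    show "V (Suc n + m) (z + cis t *s w) \<le> V (n + m) (z + cis t *s w)" for n t
      using V_mono(1)[OF m _ Wt] by simp
    show "V (n + m) (z + cis t *s w) \<le> 0" for n t
      using V_mono(2)[OF m _ Wt] by simp
    show "2 * pi * V (n + m) z \<le> integral {0..2*pi} (\<lambda>t. V (n + m) (z + cis t *s w))" for n
      by (rule V_mean_value)
  qed
  moreover have "z \<in> W m" using bspec[OF W, of 0] by simp
  ultimately show "u z \<le> ereal (1 / (2*pi)) * circle_integral (\<lambda>t. u (z + cis t *s w))"
    using u_eq_INF[OF m] Wt by simp
qed

text \<open>At the fixed point 0 the maximum is \<open>a n\<close>, and
  \<open>ln (a n) / 2 ^ n\<close> is the logarithm of the sequence in \<open>a_lim\<close>. For each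
  bound \<open>B\<close> one late term suffices, since \<open>u\<close> lies below it.\<close>

lemma u_0: "u 0 = -\<infinity>"
proof (rule ereal_bot)
  fix B :: real
  have "\<forall>\<^sub>F n in sequentially. a n powr (2 powr (- real n)) < exp (B - K)"
    by (rule order_tendstoD(2)[OF a_lim]) simp
  then have "\<forall>\<^sub>F n in sequentially. a n powr (2 powr (- real n)) < exp (B - K) \<and> N \<le> n"
    using eventually_ge_at_top[of N] by eventually_elim simp
  then obtain n where n: "a n powr (2 powr (- real n)) < exp (B - K)" "N \<le> n"
    using eventually_happens'[OF sequentially_bot] by blast
  have "ln (a n powr (2 powr (- real n))) < ln (exp (B - K))"
    using n(1) a_pos[of n] by (subst ln_less_cancel_iff) auto
  moreover have "ln (a n powr (2 powr (- real n))) = ln (a n) / 2 ^ n"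
    using a_pos[of n] by (simp add: ln_powr powr_minus powr_realpow field_simps)
  moreover have "K / 2 ^ n \<le> K / 1"
    using K_nonneg by (intro divide_left_mono) auto
  moreover have "V n 0 = ln (a n) / 2 ^ n + K / 2 ^ n"
    using Aut0_D(4)[OF G_Aut0[of n]] a_pos[of n] by (simp add: V_def add_divide_distrib max_def)
  ultimately have "V n 0 \<le> B" by simp
  then show "u 0 \<le> ereal B"
    using u_le_V[OF order_refl n(2) zero_in_W] by (meson ereal_less_eq(3) order_trans)
qed

lemma u_real_ne_MInf:
  assumes s: "0 < s" and z: "vector [of_real s, 0] \<in> basin F"
  shows "u (vector [of_real s, 0]) \<noteq> -\<infinity>"
proof -
  let ?c = "poly P 0" and ?z = "vector [of_real s, 0] :: complex ^ 2"
  \<comment> \<open>Taking logarithms in \<open>real_orbit\<close> and dividing by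
    \<open>2 ^ n\<close> leaves \<open>2 * ln (?c * s) - ln ?c / 2 ^ n\<close>; the absolute value
    bounds the last term for all \<open>n\<close>.\<close>
  define B where "B = 2 * ln (?c * s) - \<bar>ln ?c\<bar>"
  have V: "B \<le> V n ?z" for n
  proof -
    obtain x y where xy: "0 \<le> x"
      "G n ?z = vector [of_real x, of_real y]" "(?c * s) ^ (2 ^ Suc n) \<le> ?c * x"
      using real_orbit[of s n] s by auto
    have pos: "0 < (?c * s) ^ (2 ^ Suc n)" using P_0 s by simp
    then have x: "0 < x" using xy P_0 by (metis less_le_trans mult_pos_pos zero_less_mult_pos)
    have "ln ((?c * s) ^ (2 ^ Suc n)) \<le> ln (?c * x)"
      using xy(3) pos by (intro ln_mono) auto
    moreover have "ln ((?c * s) ^ (2 ^ Suc n)) = 2 ^ Suc n * ln (?c * s)"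
      using P_0 s by (simp add: ln_realpow)
    ultimately have "2 ^ n * (2 * ln (?c * s)) \<le> ln ?c + ln x"
      using P_0 x by (simp add: ln_mult)
    moreover have "ln x \<le> ln (max (cmod (G n ?z $ 1)) (a n))"
      using xy x by (intro ln_mono) auto
    moreover have "1 * \<bar>ln ?c\<bar> \<le> 2 ^ n * \<bar>ln ?c\<bar>"
      by (intro mult_right_mono) auto
    ultimately have "2 ^ n * B \<le> ln (max (cmod (G n ?z $ 1)) (a n)) + K"
      using K_nonneg by (simp add: B_def algebra_simps)
    then show ?thesis by (simp add: V_def field_simps)
  qed
  have "ereal B \<le> u ?z"
    unfolding u_def by (intro Liminf_bounded) (use V in auto)
  then show ?thesis by auto
qed

lemma short_Ck_basin: "short_Ck (basin F)"
  unfolding short_Ck_def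
proof (intro conjI)
  show "\<exists>X :: nat \<Rightarrow> (complex ^ 2) set.
     basin F = (\<Union>n. X n) \<and> (\<forall>n. X n \<subseteq> X (Suc n)) \<and> (\<forall>n. biholomorphic (X n) (ball 0 1))"
  proof (intro exI[of _ "\<lambda>n. W (n + N)"] conjI allI basin_eq)
    show "W (n + N) \<subseteq> W (Suc n + N)" for n by (rule W_mono) auto
    show "biholomorphic (W (n + N)) (ball 0 1)" for n
      unfolding W_def by (rule Aut0_biholomorphic_sublevel[OF G_Aut0 r_bounds(1)])
  qed
  show "\<exists>u. plurisubharmonic_on u (basin F) \<and> (\<exists>z\<in>basin F. \<exists>w\<in>basin F. u z \<noteq> u w) \<and>
         (\<exists>M::real. \<forall>z\<in>basin F. u z \<le> ereal M)"
  proof (intro exI[of _ u] conjI plurisubharmonic_on_u exI[of _ 0] ballI)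
    show "u z \<le> ereal 0" if "z \<in> basin F" for z
      using u_nonpos[OF that] by (simp add: zero_ereal_def)
    obtain e where e: "0 < e" "ball 0 e \<subseteq> basin F"
      using open_basin zero_in_basin open_contains_ball by blast
    \<comment> \<open>A point of the basin on the positive first axis, where \<open>u\<close> is
      finite, in contrast to 0.\<close>
    have "norm (vector [of_real (e / 2), 0] :: complex ^ 2) < e"
      using e(1) by (simp add: norm_vector_2)
    then have "vector [of_real (e / 2), 0] \<in> basin F"
      using e(2) by (metis mem_ball_0 subsetD)
    with u_real_ne_MInf[OF _ this] e(1) u_0 zero_in_basin
    show "\<exists>z\<in>basin F. \<exists>w\<in>basin F. u z \<noteq> u w"
      by (metis half_gt_zero)
  qed
qed (use open_basin connected_basin zero_in_basin basin_not_UNIV kobayashi_basin in auto)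

end

theorem theorem1p1:
  fixes a :: "nat \<Rightarrow> real"
    and P :: "real poly"
    and F :: "nat \<Rightarrow> complex ^ 2 \<Rightarrow> complex ^ 2"
  assumes a_pos: "\<And>n. 0 < a n"
    and a_lim: "(\<lambda>n. a n powr (2 powr (- real n))) \<longlonglongrightarrow> 0"
    and a_step: "\<And>n. 0 < a (Suc n) \<and> a (Suc n) < (a n)\<^sup>2 \<and> (a n)\<^sup>2 < 1"
    and P_coeffs: "\<And>i. coeff P i \<ge> 0"
    and P_0: "poly P 0 > 0"
    and F_def: "\<And>n z. F n z =
      vector [of_real (a n) * z $ 2 + (z $ 1)\<^sup>2 * poly (map_poly of_real P) (z $ 1),
              of_real (a n) * z $ 1]"
  shows "short_Ck (basin F)"
proof -
  interpret henon_sequence a P F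
    by unfold_locales (rule assms)+
  show ?thesis by (rule short_Ck_basin)
qed

end
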